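(* Let $f_1,\dots,f_k\in\mathbb{F}_{q^m}\langle X^q\rangle$ be linearized polynomials of $q$-degrees $d_1,\dots,d_k$ respectively, such that $f_1\vee_l\cdots\vee_l f_{i-1}$ is coprime with $f_i$ for all $i\in\{2,\dots,k\}$. Put $h_1=f_1$ and $h_{i+1}=h_i\vee_l f_{i+1}$ for $i\in\{1,\dots,k-1\}$, and for $i\in\{1,\dots,k-1\}$ let $S_{1,i},S_{2,i+1}\in\mathbb{F}_{q^m}\langle X^q\rangle$ be the coefficients of the Bézout relation $$S_{1,i}\circ h_i+S_{2,i+1}\circ f_{i+1}=X$$ between $h_i$ and $f_{i+1}$. Let $g\in\mathbb{F}_{q^m}\langle X^q\rangle$, and define $g_1=\pi_1(g)$ and $$g_i=\pi_i(g)\circ S_{1,i-1}\circ h_{i-1}+g_{i-1}\circ S_{2,i}\circ f_i\qquad(2\le i\le k).$$ Then $g-g_k\in(f_1\vee_l\cdots\vee_l f_k)_l$, and then, if $\deg_q(g)<\deg_q(f_1\vee_l\cdots\vee_l f_k)=d$, one has $g_k=g$.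
   Context: Let $q$ be a prime power and $m$ a positive integer. $\mathbb{F}_{q^m}\langle X^q\rangle$ is the set of linearized polynomials $\sum_{i=0}^{t} p_iX^{q^i}$, $p_i\in\mathbb{F}_{q^m}$, a non-commutative ring under addition and composition $\circ$, determined by $(aX^{q^i})\circ(bX^{q^j})=ab^{q^i}X^{q^{i+j}}$; its unit element is $X$. The $q$-degree $\deg_q(P)$ of a nonzero $P$ is the largest $i$ such that the coefficient of $X^{q^i}$ is nonzero. For $B\neq0$, right division of $P$ by $B$ is the unique writing $P=Q\circ B+R$ with $R=0$ or $\deg_q(R)<\deg_q(B)$; $R$ is the remainder. $\pi_i(g)$ denotes the remainder of the right division of $g$ by $f_i$. $(P)_l$ is the left ideal generated by $P$, i.e. $\{Q\circ P : Q\in\mathbb{F}_{q^m}\langle X^q\rangle\}$. $P\vee_l B$ denotes the left least common multiple of $P$ and $B$ (a generator of $(P)_l\cap(B)_l$). Two linearized polynomials are coprime if their greatest right common divisor is $X$ (up to a nonzero scalar), equivalently if they satisfy a Bézout relation $U\circ P+V\circ B=X$.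
   Formalization: The final claim g_k = g fails literally (q=2, m=1, f_1=X^2, f_2=X^4+X, S_{1,1}=X^2, S_{2,2}=X, g=X^2 give g_2=X^8); proved instead: the remainder of g_k modulo f_1∨_l…∨_l f_k equals g, and g_k=g whenever g_k is zero or deg_q(g_k)<d. *)

theory Defs
  imports
    "HOL-Computational_Algebra.Computational_Algebra"
    "HOL-Number_Theory.Prime_Powers"
    "HOL-Library.Cardinality"
begin

text \<open>
  Linearized polynomials are taken as ordinary polynomials all of whose exponents are powers
  of \<open>q\<close>. Their composition is \<^const>\<open>pcompose\<close>, with unit the polynomial \<open>X = [:0, 1:]\<close>.
\<close>

definition lin_polys :: "nat \<Rightarrow> 'a::field poly set" where
  "lin_polys q = {P. \<exists>t p. P = (\<Sum>i\<le>t. monom (p i) (q ^ i))}"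

text \<open>Meaningful only for nonzero \<open>P\<close>.\<close>

definition qdeg :: "nat \<Rightarrow> 'a::field poly \<Rightarrow> nat" where
  "qdeg q P = Max {i. coeff P (q ^ i) \<noteq> 0}"

text \<open>Comparison of \<open>q\<close>-degrees, where the zero polynomial counts as smaller than anything.\<close>

definition qdeg_less :: "nat \<Rightarrow> 'a::field poly \<Rightarrow> 'a poly \<Rightarrow> bool" where
  "qdeg_less q R B \<longleftrightarrow> R = 0 \<or> qdeg q R < qdeg q B"

definition rrem :: "nat \<Rightarrow> 'a::field poly \<Rightarrow> 'a poly \<Rightarrow> 'a poly" where
  "rrem q P B = (THE R. R \<in> lin_polys q \<and> qdeg_less q R B \<and>
     (\<exists>Q\<in>lin_polys q. P = Q \<circ>\<^sub>p B + R))"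

definition left_ideal :: "nat \<Rightarrow> 'a::field poly \<Rightarrow> 'a poly set" where
  "left_ideal q P = {Q \<circ>\<^sub>p P | Q. Q \<in> lin_polys q}"

text \<open>
  Left least common multiples are unique only up to a nonzero scalar, so they are described by
  a relation: \<open>M\<close> is a left least common multiple of the set \<open>A\<close>.
\<close>

definition is_llcm :: "nat \<Rightarrow> 'a::field poly set \<Rightarrow> 'a poly \<Rightarrow> bool" where
  "is_llcm q A M \<longleftrightarrow> M \<in> lin_polys q \<and> left_ideal q M = (\<Inter>P\<in>A. left_ideal q P)"

definition rdvd :: "nat \<Rightarrow> 'a::field poly \<Rightarrow> 'a poly \<Rightarrow> bool" where
  "rdvd q D P \<longleftrightarrow> (\<exists>Q\<in>lin_polys q. P = Q \<circ>\<^sub>p D)"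

definition is_grcd :: "nat \<Rightarrow> 'a::field poly \<Rightarrow> 'a poly \<Rightarrow> 'a poly \<Rightarrow> bool" where
  "is_grcd q P B D \<longleftrightarrow> D \<in> lin_polys q \<and> rdvd q D P \<and> rdvd q D B \<and>
     (\<forall>E\<in>lin_polys q. rdvd q E P \<longrightarrow> rdvd q E B \<longrightarrow> rdvd q E D)"

definition lin_coprime :: "nat \<Rightarrow> 'a::field poly \<Rightarrow> 'a poly \<Rightarrow> bool" where
  "lin_coprime q P B \<longleftrightarrow> (\<exists>a. a \<noteq> 0 \<and> is_grcd q P B [:0, a:])"

end

theory Submission
  imports "HOL-Number_Theory.Residues" Defs
begin

text \<open>
  Write \<open>\<pi>\<^sub>i(g)\<close> for \<open>rrem q g (f i)\<close>. Composition with \<open>g\<close> on the left is additive, so composing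
  \<open>g\<close> with the Bezout relation shows that \<open>g - gs i\<close> equals
  \<open>(g - \<pi>\<^sub>i(g)) \<circ> S1 (i - 1) \<circ> h (i - 1) + (g - gs (i - 1)) \<circ> S2 i \<circ> f i\<close>.
  Here \<open>g - \<pi>\<^sub>i(g)\<close> is a left multiple of \<open>f i\<close> and, inductively, \<open>g - gs (i - 1)\<close> one of
  \<open>h (i - 1)\<close>. If \<open>A\<close> is a left multiple of \<open>f\<close>, the same relation gives
  \<open>A \<circ> S1 \<circ> h = A - A \<circ> S2 \<circ> f\<close>, so this is a left multiple of both \<open>f\<close> and \<open>h\<close>; the other
  summand is symmetric. Hence \<open>g - gs i\<close> is a left multiple of \<open>h i\<close>, and the rest is uniqueness
  of remainders.
\<close>

section \<open>Linearized polynomials as a ring under composition\<close>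

lemma monom_pcompose: "monom c n \<circ>\<^sub>p P = smult c (P ^ n)" for P :: "'a::comm_semiring_1 poly"
  by (induction n) (simp_all add: monom_0 monom_Suc pcompose_pCons)

text \<open>Since \<open>q\<close> is a positive power of the characteristic, raising to the power
  \<open>q ^ i\<close> is additive; \<open>q > 1\<close> keeps the exponents \<open>q ^ i\<close>
  distinct.\<close>

locale frobenius_power =
  fixes q r :: nat and ty :: "'a::field itself"
  assumes prime_CHAR: "prime CHAR('a)" and q_eq: "q = CHAR('a) ^ r" and r_pos: "r > 0"
begin

lemma q_gt_1: "q > 1"
  unfolding q_eq by (intro one_less_power prime_gt_1_nat prime_CHAR r_pos)

lemma q_power_inject [simp]: "q ^ i = q ^ j \<longleftrightarrow> i = j"
  using q_gt_1 by (intro power_inject_exp)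

lemma power_q_add:
  fixes P Q :: "'a poly"
  shows "(P + Q) ^ (q ^ i) = P ^ (q ^ i) + Q ^ (q ^ i)"
  by (rule freshmans_dream'[where n = "r * i"]) (simp_all add: prime_CHAR q_eq power_mult)

lemma power_q_sum:
  fixes P :: "'b \<Rightarrow> 'a poly"
  shows "sum P A ^ (q ^ i) = (\<Sum>x\<in>A. P x ^ (q ^ i))"
  by (rule freshmans_dream_sum'[where n = "r * i"]) (simp_all add: prime_CHAR q_eq power_mult)

text \<open>A description by support avoids the bound \<open>t\<close> and the family
  \<open>p\<close>, so closure under sums and scalars can be checked coefficientwise. Conversely,
  \<open>degree P\<close> serves as the bound because \<open>j < q ^ j\<close>.\<close>

lemma lin_polys_iff:
  fixes P :: "'a poly"
  shows "P \<in> lin_polys q \<longleftrightarrow> (\<forall>n. coeff P n \<noteq> 0 \<longrightarrow> n \<in> range ((^) q))"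
proof
  assume "P \<in> lin_polys q"
  then obtain t p where P: "P = (\<Sum>i\<le>t. monom (p i) (q ^ i))"
    by (auto simp: lin_polys_def)
  show "\<forall>n. coeff P n \<noteq> 0 \<longrightarrow> n \<in> range ((^) q)"
  proof (intro allI impI)
    fix n assume "coeff P n \<noteq> 0"
    then obtain i where "coeff (monom (p i) (q ^ i)) n \<noteq> 0"
      unfolding P coeff_sum by (meson sum.neutral)
    then show "n \<in> range ((^) q)"
      by (auto split: if_splits)
  qed
next
  assume *: "\<forall>n. coeff P n \<noteq> 0 \<longrightarrow> n \<in> range ((^) q)"
  have "P = (\<Sum>i\<le>degree P. monom (coeff P (q ^ i)) (q ^ i))"
  proof (rule poly_eqI)
    fix n
    show "coeff P n = coeff (\<Sum>i\<le>degree P. monom (coeff P (q ^ i)) (q ^ i)) n"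
    proof (cases "n \<in> range ((^) q)")
      case True
      then obtain j where n: "n = q ^ j" by auto
      have "coeff P (q ^ j) = 0" if "\<not> j \<le> degree P"
        using that power_gt_expt[of q j] q_gt_1 by (intro coeff_eq_0) simp
      then show ?thesis
        by (simp add: n coeff_sum sum.delta)
    next
      case False
      then have "\<And>i. q ^ i \<noteq> n" by auto
      moreover have "coeff P n = 0" using False * by auto
      ultimately show ?thesis by (simp add: coeff_sum)
    qed
  qed
  then show "P \<in> lin_polys q"
    unfolding lin_polys_def
    by (intro CollectI exI[of _ "degree P"] exI[of _ "\<lambda>i. coeff P (q ^ i)"])
qed

lemma lin_polys_0 [simp]: "(0 :: 'a poly) \<in> lin_polys q"
  by (simp add: lin_polys_iff)

lemma lin_polys_monom [simp]: "monom (c :: 'a) (q ^ i) \<in> lin_polys q"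
  by (auto simp: lin_polys_iff)

lemma lin_polys_add [intro]:
  fixes P Q :: "'a poly"
  assumes "P \<in> lin_polys q" "Q \<in> lin_polys q"
  shows "P + Q \<in> lin_polys q"
  unfolding lin_polys_iff
proof (intro allI impI)
  fix n assume "coeff (P + Q) n \<noteq> 0"
  then have "coeff P n \<noteq> 0 \<or> coeff Q n \<noteq> 0" by auto
  then show "n \<in> range ((^) q)"
    using assms by (meson lin_polys_iff)
qed

lemma lin_polys_smult [intro]:
  fixes P :: "'a poly"
  assumes "P \<in> lin_polys q"
  shows "smult c P \<in> lin_polys q"
  using assms by (auto simp: lin_polys_iff)

lemma lin_polys_uminus [intro]:
  fixes P :: "'a poly"
  assumes "P \<in> lin_polys q"
  shows "- P \<in> lin_polys q"
  using assms by (auto simp: lin_polys_iff)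

lemma lin_polys_diff [intro]:
  fixes P Q :: "'a poly"
  assumes "P \<in> lin_polys q" "Q \<in> lin_polys q"
  shows "P - Q \<in> lin_polys q"
  using lin_polys_add[OF assms(1) lin_polys_uminus[OF assms(2)]] by simp

lemma lin_polys_sum:
  fixes P :: "'b \<Rightarrow> 'a poly"
  assumes "\<And>x. x \<in> A \<Longrightarrow> P x \<in> lin_polys q"
  shows "sum P A \<in> lin_polys q"
  using assms by (induction A rule: infinite_finite_induct) auto

lemma lin_polys_power_q:
  fixes P :: "'a poly"
  assumes "P \<in> lin_polys q"
  shows "P ^ (q ^ i) \<in> lin_polys q"
proof -
  obtain t p where P: "P = (\<Sum>j\<le>t. monom (p j) (q ^ j))"
    using assms by (auto simp: lin_polys_def)
  show ?thesis
    unfolding P power_q_sum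
    by (intro lin_polys_sum) (simp add: monom_power flip: power_add)
qed

lemma lin_polys_pcompose [intro]:
  fixes P Q :: "'a poly"
  assumes "P \<in> lin_polys q" "Q \<in> lin_polys q"
  shows "P \<circ>\<^sub>p Q \<in> lin_polys q"
proof -
  obtain t p where P: "P = (\<Sum>j\<le>t. monom (p j) (q ^ j))"
    using assms by (auto simp: lin_polys_def)
  show ?thesis
    unfolding P pcompose_sum monom_pcompose
    by (intro lin_polys_sum lin_polys_smult lin_polys_power_q assms)
qed

text \<open>For arbitrary polynomials, composition distributes over sums only in its left argument.
  Here each monomial of \<open>P\<close> acts as a scalar times a Frobenius power, which is
  additive.\<close>

lemma pcompose_add_right:
  fixes P A B :: "'a poly"
  assumes "P \<in> lin_polys q"
  shows "P \<circ>\<^sub>p (A + B) = P \<circ>\<^sub>p A + P \<circ>\<^sub>p B"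
proof -
  obtain t p where P: "P = (\<Sum>j\<le>t. monom (p j) (q ^ j))"
    using assms by (auto simp: lin_polys_def)
  show ?thesis
    unfolding P pcompose_sum monom_pcompose power_q_add
    by (simp add: smult_add_right sum.distrib)
qed

section \<open>The \<open>q\<close>-degree and right division\<close>

lemma lin_polys_degree:
  fixes P :: "'a poly"
  assumes "P \<in> lin_polys q" "P \<noteq> 0"
  shows "degree P = q ^ qdeg q P"
proof -
  have lead: "lead_coeff P \<noteq> 0" using assms by simp
  then have "degree P \<in> range ((^) q)"
    using assms(1)[unfolded lin_polys_iff, rule_format, of "degree P"] by simp
  then obtain n where n: "degree P = q ^ n" by (rule rangeE)
  have le: "i \<le> n" if "coeff P (q ^ i) \<noteq> 0" for i
  proof -
    have "q ^ i \<le> q ^ n" using le_degree[OF that] by (simp only: n)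
    then show ?thesis using power_increasing_iff[OF q_gt_1] by blast
  qed
  have "qdeg q P = n"
    unfolding qdeg_def
  proof (rule Max_eqI)
    show "finite {i. coeff P (q ^ i) \<noteq> 0}"
      by (rule finite_subset[of _ "{..n}"]) (use le in blast, simp)
    show "n \<in> {i. coeff P (q ^ i) \<noteq> 0}"
      using lead by (simp only: n mem_Collect_eq not_False_eq_True)
  qed (use le in blast)
  then show ?thesis by (simp only: n)
qed

text \<open>Reduces to ordinary degrees through \<open>lin_polys_degree\<close>. The case
  \<open>R = 0\<close> fits because \<open>degree B\<close> is a power of \<open>q\<close>, hence
  positive.\<close>

lemma qdeg_less_iff:
  fixes R B :: "'a poly"
  assumes "R \<in> lin_polys q" "B \<in> lin_polys q" "B \<noteq> 0"
  shows "qdeg_less q R B \<longleftrightarrow> degree R < degree B"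
  using assms q_gt_1 by (cases "R = 0") (simp_all add: qdeg_less_def lin_polys_degree)

text \<open>Euclidean division by strong induction on \<open>degree A\<close>: subtracting a
  suitable \<open>T \<circ>\<^sub>p B\<close> cancels the leading term of \<open>A\<close>.\<close>

lemma lin_polys_division:
  fixes A B :: "'a poly"
  assumes "A \<in> lin_polys q" "B \<in> lin_polys q" "B \<noteq> 0"
  obtains Q R where "Q \<in> lin_polys q" "R \<in> lin_polys q" "qdeg_less q R B" "A = Q \<circ>\<^sub>p B + R"
proof -
  have "\<exists>Q\<in>lin_polys q. \<exists>R\<in>lin_polys q. qdeg_less q R B \<and> A = Q \<circ>\<^sub>p B + R"
    using assms(1)
  proof (induction "degree A" arbitrary: A rule: less_induct)
    case less
    show ?case
    proof (cases "degree A < degree B")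
      case True
      then show ?thesis
        using less.prems assms(2,3)
        by (intro bexI[of _ 0] bexI[of _ A]) (simp_all add: qdeg_less_iff)
    next
      case False
      have "degree B > 0"
        using lin_polys_degree[OF assms(2,3)] q_gt_1 by simp
      with False have "A \<noteq> 0" by auto
      define e where "e = qdeg q A - qdeg q B"
      \<comment> \<open>Composing with \<open>monom c (q ^ e)\<close> raises the leading coefficient
        of \<open>B\<close> to the power \<open>q ^ e\<close>, so this power is divided out.\<close>
      define c where "c = lead_coeff A / lead_coeff B ^ (q ^ e)"
      define T where "T = monom c (q ^ e)"
      have degA: "degree A = q ^ qdeg q A" and degB: "degree B = q ^ qdeg q B"
        using less.prems assms \<open>A \<noteq> 0\<close> by (simp_all add: lin_polys_degree)
      with False q_gt_1 have le: "qdeg q B \<le> qdeg q A" by simp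
      have c0: "c \<noteq> 0" using \<open>A \<noteq> 0\<close> \<open>B \<noteq> 0\<close> by (simp add: c_def)
      have deg_eq: "degree (T \<circ>\<^sub>p B) = degree A"
        unfolding T_def degree_pcompose using c0 le
        by (simp add: degree_monom_eq degA degB e_def flip: power_add)
      have lead_eq: "lead_coeff (T \<circ>\<^sub>p B) = lead_coeff A"
        unfolding T_def monom_pcompose lead_coeff_smult lead_coeff_power
        using \<open>B \<noteq> 0\<close> by (simp add: c_def)
      have "degree (A - T \<circ>\<^sub>p B) < degree A"
      proof -
        have "degree (A - T \<circ>\<^sub>p B) \<le> degree A"
          using degree_diff_le[of A "degree A" "T \<circ>\<^sub>p B"] deg_eq by simp
        moreover have "coeff (A - T \<circ>\<^sub>p B) (degree A) = 0"
          using lead_eq deg_eq by simp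
        ultimately have "A - T \<circ>\<^sub>p B = 0 \<or> degree (A - T \<circ>\<^sub>p B) < degree A"
          by (rule eq_zero_or_degree_less)
        \<comment> \<open>A zero difference also has smaller degree, since
          \<open>degree A \<ge> degree B > 0\<close>.\<close>
        then show ?thesis using False \<open>degree B > 0\<close> by auto
      qed
      moreover have T: "T \<in> lin_polys q" by (simp add: T_def)
      ultimately obtain Q R where QR: "Q \<in> lin_polys q" "R \<in> lin_polys q" "qdeg_less q R B"
        "A - T \<circ>\<^sub>p B = Q \<circ>\<^sub>p B + R"
        using less.hyps[of "A - T \<circ>\<^sub>p B"] less.prems assms(2)
        by (metis lin_polys_diff lin_polys_pcompose)
      then have "A = (T + Q) \<circ>\<^sub>p B + R"
        by (simp add: pcompose_add algebra_simps)
      with QR T show ?thesis by blast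
    qed
  qed
  with that show ?thesis by blast
qed

section \<open>Left ideals and uniqueness of remainders\<close>

lemma left_idealI [intro]: "Q \<in> lin_polys q \<Longrightarrow> Q \<circ>\<^sub>p P \<in> left_ideal q P" for P :: "'a poly"
  by (auto simp: left_ideal_def)

lemma left_ideal_add [intro]:
  "A \<in> left_ideal q P \<Longrightarrow> B \<in> left_ideal q P \<Longrightarrow> A + B \<in> left_ideal q P" for P :: "'a poly"
  unfolding left_ideal_def using lin_polys_add by (force simp flip: pcompose_add)

lemma left_ideal_diff [intro]:
  "A \<in> left_ideal q P \<Longrightarrow> B \<in> left_ideal q P \<Longrightarrow> A - B \<in> left_ideal q P" for P :: "'a poly"
  unfolding left_ideal_def using lin_polys_diff by (force simp flip: pcompose_diff)

text \<open>
  For \<open>B = 0\<close> the \<open>q\<close>-degree of \<open>B\<close> is an unspecified number, but then the ideal is zero and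
  remainders are still unique.
\<close>

lemma qdeg_less_unique:
  fixes R R' B :: "'a poly"
  assumes "R \<in> lin_polys q" "R' \<in> lin_polys q" "B \<in> lin_polys q"
    and "qdeg_less q R B" "qdeg_less q R' B" "R - R' \<in> left_ideal q B"
  shows "R = R'"
proof -
  obtain Q where Q: "Q \<in> lin_polys q" "R - R' = Q \<circ>\<^sub>p B"
    using assms(6) by (auto simp: left_ideal_def)
  \<comment> \<open>The missing constant term settles both cases: for \<open>B = 0\<close> the
    composition is that constant, and otherwise the degree bound forces \<open>Q\<close> to be
    constant.\<close>
  have "0 \<notin> range ((^) q)" using q_gt_1 by auto
  then have Q0: "coeff Q 0 = 0" using Q(1) by (meson lin_polys_iff)
  show ?thesis
  proof (cases "B = 0")
    case True
    then show ?thesis using Q(2) Q0 by (simp add: pcompose_0')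
  next
    case False
    then have "degree R < degree B" "degree R' < degree B"
      using assms by (simp_all add: qdeg_less_iff)
    then have "degree (Q \<circ>\<^sub>p B) < degree B"
      using degree_diff_less[of R "degree B" R'] Q(2) by simp
    then have "degree Q = 0"
      by (simp add: degree_pcompose)
    with Q0 have "Q = 0"
      by (metis leading_coeff_0_iff)
    with Q show ?thesis by simp
  qed
qed

text \<open>Resolves the definite description in \<open>rrem\<close>. Allowing \<open>B = 0\<close>
  lets it apply to \<open>M\<close> without first showing \<open>M\<close> nonzero.\<close>

lemma rrem_eqI:
  fixes A B R :: "'a poly"
  assumes "B \<in> lin_polys q" "R \<in> lin_polys q" "qdeg_less q R B" "A - R \<in> left_ideal q B"
  shows "rrem q A B = R"
  unfolding rrem_def
proof (rule the_equality)
  obtain Q where "Q \<in> lin_polys q" "A - R = Q \<circ>\<^sub>p B"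
    using assms(4) by (auto simp: left_ideal_def)
  then show "R \<in> lin_polys q \<and> qdeg_less q R B \<and> (\<exists>Q\<in>lin_polys q. A = Q \<circ>\<^sub>p B + R)"
    using assms by (metis diff_add_cancel)
next
  fix R' assume R': "R' \<in> lin_polys q \<and> qdeg_less q R' B \<and> (\<exists>Q\<in>lin_polys q. A = Q \<circ>\<^sub>p B + R')"
  then have "A - R' \<in> left_ideal q B" by auto
  then have "(A - R) - (A - R') \<in> left_ideal q B" using assms(4) by blast
  then have "R' - R \<in> left_ideal q B" by simp
  with R' assms show "R' = R" using qdeg_less_unique by blast
qed

lemma diff_rrem_in_left_ideal:
  fixes A B :: "'a poly"
  assumes "A \<in> lin_polys q" "B \<in> lin_polys q" "B \<noteq> 0"
  shows "A - rrem q A B \<in> left_ideal q B"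
proof -
  obtain Q R where QR: "Q \<in> lin_polys q" "R \<in> lin_polys q" "qdeg_less q R B" "A = Q \<circ>\<^sub>p B + R"
    using lin_polys_division[OF assms] .
  then have "A - R \<in> left_ideal q B" by auto
  then show ?thesis using rrem_eqI QR assms by metis
qed

text \<open>Used twice in the induction step, the second time with the roles of \<open>h i\<close>
  and \<open>f (Suc i)\<close> exchanged.\<close>

lemma bezout_cross_term:
  fixes F H S T A :: "'a poly"
  assumes "F \<in> lin_polys q" "S \<in> lin_polys q" "T \<in> lin_polys q" "H \<in> lin_polys q"
    and bez: "S \<circ>\<^sub>p H + T \<circ>\<^sub>p F = [:0, 1:]"
    and "A \<in> left_ideal q F"
  shows "A \<circ>\<^sub>p S \<circ>\<^sub>p H \<in> left_ideal q F \<inter> left_ideal q H"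
proof -
  obtain Q where Q: "Q \<in> lin_polys q" "A = Q \<circ>\<^sub>p F"
    using assms(6) by (auto simp: left_ideal_def)
  then have A: "A \<in> lin_polys q" using assms by auto
  have "A \<circ>\<^sub>p (S \<circ>\<^sub>p H) + A \<circ>\<^sub>p (T \<circ>\<^sub>p F) = A"
    using pcompose_add_right[OF A, of "S \<circ>\<^sub>p H" "T \<circ>\<^sub>p F"] bez by simp
  then have "A \<circ>\<^sub>p S \<circ>\<^sub>p H = A - A \<circ>\<^sub>p T \<circ>\<^sub>p F"
    by (simp add: pcompose_assoc eq_diff_eq)
  moreover have "A - A \<circ>\<^sub>p T \<circ>\<^sub>p F \<in> left_ideal q F"
    using A assms by (intro left_ideal_diff left_idealI lin_polys_pcompose)
  moreover have "A \<circ>\<^sub>p S \<circ>\<^sub>p H \<in> left_ideal q H"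
    using A assms by (intro left_idealI lin_polys_pcompose)
  ultimately show ?thesis by auto
qed

end

section \<open>Chinese remaindering along the chain of least common multiples\<close>

theorem theorem12:
  fixes q m k :: nat
    and f h S1 S2 gs :: "nat \<Rightarrow> 'a::{field,finite} poly"
    and d :: "nat \<Rightarrow> nat"
    and g :: "'a poly"
  assumes q: "primepow q"
    and m: "m \<ge> 1"
    and card: "CARD('a) = q ^ m"
    and k: "k \<ge> 1"
    and f: "\<And>i. i \<in> {1..k} \<Longrightarrow> f i \<in> lin_polys q \<and> f i \<noteq> 0 \<and> qdeg q (f i) = d i"
    and coprime: "\<And>i M. i \<in> {2..k} \<Longrightarrow> is_llcm q (f ` {1..i - 1}) M \<Longrightarrow> lin_coprime q M (f i)"
    and h_1: "h 1 = f 1"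
    and h_Suc: "\<And>i. i \<in> {1..k - 1} \<Longrightarrow> is_llcm q {h i, f (i + 1)} (h (i + 1))"
    and S1: "\<And>i. i \<in> {1..k - 1} \<Longrightarrow> S1 i \<in> lin_polys q"
    and S2: "\<And>i. i \<in> {1..k - 1} \<Longrightarrow> S2 (i + 1) \<in> lin_polys q"
    and bezout: "\<And>i. i \<in> {1..k - 1} \<Longrightarrow> S1 i \<circ>\<^sub>p h i + S2 (i + 1) \<circ>\<^sub>p f (i + 1) = [:0, 1:]"
    and g: "g \<in> lin_polys q"
    and gs_1: "gs 1 = rrem q g (f 1)"
    and gs_rec: "\<And>i. i \<in> {2..k} \<Longrightarrow>
      gs i = rrem q g (f i) \<circ>\<^sub>p S1 (i - 1) \<circ>\<^sub>p h (i - 1) + gs (i - 1) \<circ>\<^sub>p S2 i \<circ>\<^sub>p f i"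
    and M: "is_llcm q (f ` {1..k}) M"
  shows "g - gs k \<in> left_ideal q M \<and>
    (qdeg_less q g M \<longrightarrow>
       rrem q (gs k) M = g \<and> (qdeg_less q (gs k) M \<longrightarrow> gs k = g))"
proof -
  obtain p n where p: "prime p" "n > 0" "q = p ^ n"
    using q by (auto simp: primepow_def)
  have pC: "prime CHAR('a)"
    by (intro prime_CHAR_semidom finite_imp_CHAR_pos) simp
  \<comment> \<open>The characteristic is a prime dividing the size of the field, a power of
    \<open>p\<close>, so it equals \<open>p\<close>.\<close>
  have "CHAR('a) dvd p ^ (n * m)"
    using CHAR_dvd_CARD[where 'a = 'a] by (simp add: card p power_mult)
  with pC p have "CHAR('a) = p"
    using prime_dvd_power primes_dvd_imp_eq by blast
  then interpret frobenius_power q n "TYPE('a)"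
    using p pC by unfold_locales auto
  \<comment> \<open>As \<open>M\<close> and \<open>h k\<close> may be different generators, they are
    compared through their ideals; the intersection formula in the invariant provides this.\<close>
  have step: "h i \<in> lin_polys q \<and> left_ideal q (h i) = (\<Inter>P\<in>f ` {1..i}. left_ideal q P) \<and>
      g - gs i \<in> left_ideal q (h i)"
    if "i \<ge> 1" "i \<le> k" for i
    using that
  proof (induction i rule: dec_induct)
    case base
    have "g - gs 1 \<in> left_ideal q (f 1)"
      using f[of 1] base k g diff_rrem_in_left_ideal gs_1 by simp
    then show ?case using f[of 1] k h_1 by simp
  next
    case (step i)
    then have i: "i \<in> {1..k - 1}" and i1: "Suc i \<in> {1..k}" and i2: "Suc i \<in> {2..k}" by auto
    from step have h: "h i \<in> lin_polys q"
      and ideal: "left_ideal q (h i) = (\<Inter>P\<in>f ` {1..i}. left_ideal q P)"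
      and diff: "g - gs i \<in> left_ideal q (h i)" by auto
    define F where "F = f (Suc i)"
    have F: "F \<in> lin_polys q" "F \<noteq> 0" using f[OF i1] by (auto simp: F_def)
    have S: "S1 i \<in> lin_polys q" "S2 (Suc i) \<in> lin_polys q"
      and bez: "S1 i \<circ>\<^sub>p h i + S2 (Suc i) \<circ>\<^sub>p F = [:0, 1:]"
      using S1[OF i] S2[OF i] bezout[OF i] by (simp_all add: F_def)
    have bez': "S2 (Suc i) \<circ>\<^sub>p F + S1 i \<circ>\<^sub>p h i = [:0, 1:]"
      using bez by (simp only: add.commute)
    have hS: "h (Suc i) \<in> lin_polys q"
      "left_ideal q (h (Suc i)) = left_ideal q F \<inter> left_ideal q (h i)"
      using h_Suc[OF i] by (auto simp: is_llcm_def F_def)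
    have "g = g \<circ>\<^sub>p (S1 i \<circ>\<^sub>p h i) + g \<circ>\<^sub>p (S2 (Suc i) \<circ>\<^sub>p F)"
      using pcompose_add_right[OF g, of "S1 i \<circ>\<^sub>p h i" "S2 (Suc i) \<circ>\<^sub>p F"] bez by simp
    then have "g - gs (Suc i) =
        (g - rrem q g F) \<circ>\<^sub>p S1 i \<circ>\<^sub>p h i + (g - gs i) \<circ>\<^sub>p S2 (Suc i) \<circ>\<^sub>p F"
      using gs_rec[OF i2] by (simp add: F_def pcompose_diff pcompose_assoc algebra_simps)
    moreover have "(g - rrem q g F) \<circ>\<^sub>p S1 i \<circ>\<^sub>p h i \<in> left_ideal q (h (Suc i))"
      unfolding hS using F S h bez g
      by (intro bezout_cross_term[of F _ "S2 (Suc i)"] diff_rrem_in_left_ideal)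
    moreover have "(g - gs i) \<circ>\<^sub>p S2 (Suc i) \<circ>\<^sub>p F \<in> left_ideal q (h (Suc i))"
      unfolding hS using bezout_cross_term[OF h S(2,1) F(1) bez' diff] by blast
    ultimately have "g - gs (Suc i) \<in> left_ideal q (h (Suc i))" by auto
    moreover have "{1..Suc i} = insert (Suc i) {1..i}" by auto
    ultimately show ?case using hS ideal by (simp add: F_def)
  qed
  have Mlin: "M \<in> lin_polys q" and "left_ideal q M = left_ideal q (h k)"
    using M step[of k] k by (auto simp: is_llcm_def)
  then have diff: "g - gs k \<in> left_ideal q M" using step[of k] k by blast
  \<comment> \<open>The hypotheses do not bound the \<open>q\<close>-degree of \<open>gs k\<close>,
    so \<open>g\<close> is recovered as its remainder modulo \<open>M\<close>.\<close>
  have rem: "rrem q (gs k) M = g" if "qdeg_less q g M"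
  proof -
    have "0 - (g - gs k) \<in> left_ideal q M"
      using left_idealI[OF lin_polys_0, of M] by (intro left_ideal_diff[OF _ diff]) simp
    then show ?thesis using that Mlin g by (intro rrem_eqI) simp_all
  qed
  \<comment> \<open>Instead of unfolding the recursion, \<open>gs k\<close> is written as
    \<open>g\<close> minus an element of the ideal of \<open>M\<close>.\<close>
  have gs_lin: "gs k \<in> lin_polys q"
  proof -
    obtain Q where "Q \<in> lin_polys q" "g - gs k = Q \<circ>\<^sub>p M"
      using diff by (auto simp: left_ideal_def)
    then have "g - gs k \<in> lin_polys q" using Mlin by auto
    then have "g - (g - gs k) \<in> lin_polys q" by (rule lin_polys_diff[OF g])
    then show ?thesis by simp
  qed
  have "gs k = g" if "qdeg_less q g M" "qdeg_less q (gs k) M"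
    using qdeg_less_unique[OF g gs_lin Mlin that diff] by (rule sym)
  with diff rem show ?thesis by simp
qed

end
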